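(* Let $f\in C^{0}(\mathbb{R}^n\times\mathbb{R}^m;\mathbb{R}^n)$ give rise to the control system $\dot{x}=f(x,u)$. If there is a convex control Lyapunov function (CLF) $V\in C^{\infty}(\mathbb{R}^n;\mathbb{R}_{\geq 0})$ for this control system with respect to $0$, then $V$ is a CLF with respect to $0$ for every control system on the straight-line homotopy between $f$ and the map $(x,u)\mapsto -x$; that is, for every $s\in[0,1]$, $V$ is a CLF with respect to $0$ for $\dot{x}=(1-s)f(x,u)-s\,x$.
   Context: A function $V\in C^{\infty}(\mathbb{R}^n;\mathbb{R}_{\geq 0})$ is a control Lyapunov function (CLF) for a control system $\dot x=h(x,u)$, $h\in C^0(\mathbb{R}^n\times\mathbb{R}^m;\mathbb{R}^n)$, with respect to $0$ if (a) $V(0)=0$ and $V(x)>0$ for all $x\neq 0$; (b) for every $x\in\mathbb{R}^n\setminus\{0\}$, $\inf_{u\in\mathbb{R}^m}\langle\nabla V(x),h(x,u)\rangle<0$; (c) $V(x)\to+\infty$ as $\|x\|\to+\infty$. *)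

theory Defs
  imports "HOL-Analysis.Analysis"
begin

(* C^k on the whole space, by recursion on k through directional derivatives (so that the
   codomain type stays the same). Since the domain is finite-dimensional, continuity of all
   the maps x |-> Df(x) v is continuity of x |-> Df(x). *)
primrec C_k :: "nat \<Rightarrow> ('a::euclidean_space \<Rightarrow> 'b::euclidean_space) \<Rightarrow> bool" where
  "C_k 0 f \<longleftrightarrow> continuous_on UNIV f"
| "C_k (Suc k) f \<longleftrightarrow>
     (\<forall>x. f differentiable (at x)) \<and> (\<forall>v. C_k k (\<lambda>x. frechet_derivative f (at x) v))"

definition C_infinity :: "('a::euclidean_space \<Rightarrow> 'b::euclidean_space) \<Rightarrow> bool" where
  "C_infinity f \<longleftrightarrow> (\<forall>k. C_k k f)"

(* Unspecified where V is not differentiable; only used for smooth V. *)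
definition gradient :: "('a::euclidean_space \<Rightarrow> real) \<Rightarrow> 'a \<Rightarrow> 'a" where
  "gradient V x = (THE D. GDERIV V x :> D)"

(* The infimum is taken in the extended reals, because it may be -\<infinity>. *)
definition control_lyapunov_function ::
    "(real^'n \<Rightarrow> real) \<Rightarrow> ((real^'n) \<times> (real^'m) \<Rightarrow> real^'n) \<Rightarrow> bool" where
  "control_lyapunov_function V h \<longleftrightarrow>
     continuous_on UNIV h \<and>
     C_infinity V \<and> (\<forall>x. V x \<ge> 0) \<and>
     V 0 = 0 \<and> (\<forall>x. x \<noteq> 0 \<longrightarrow> V x > 0) \<and>
     (\<forall>x. x \<noteq> 0 \<longrightarrow> (INF u. ereal (inner (gradient V x) (h (x, u)))) < 0) \<and>
     filterlim V at_top at_infinity"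

end

(* Convexity gives <grad V(x), -x> <= V(0) - V(x) < 0 for x \<noteq> 0, so V also decreases along -x.
   A control u that makes V decrease along f(x, u) therefore does so along the whole segment
   from f(x, u) to -x. *)
theory Submission
  imports Defs
begin

text \<open>This makes the definite description in \<open>gradient\<close> meaningful. Existence is
  the Riesz representation of the derivative, and uniqueness follows from uniqueness of
  derivatives.\<close>

lemma GDERIV_gradient:
  fixes V :: "'a::euclidean_space \<Rightarrow> real"
  assumes "V differentiable (at x)"
  shows "GDERIV V x :> gradient V x"
proof -
  obtain D where D: "(V has_derivative D) (at x)"
    using assms by (auto simp: differentiable_def)
  interpret D: bounded_linear D
    using D by (rule has_derivative_bounded_linear)
  \<comment> \<open>On the reals \<open>inner (D h) 1\<close> is \<open>D h\<close>, so moving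
    \<open>D\<close> to the other side yields the representing vector.\<close>
  define g where "g = adjoint D 1"
  have "D = (\<lambda>h. inner h g)"
    using adjoint_works[OF D.linear, of _ 1] by (simp add: g_def fun_eq_iff)
  with D have g: "GDERIV V x :> g"
    by (simp add: gderiv_def)
  have "g' = g" if "GDERIV V x :> g'" for g'
  proof -
    have "(\<lambda>h. inner h g') = (\<lambda>h. inner h g)"
      using that g unfolding gderiv_def by (rule has_derivative_unique)
    \<comment> \<open>Testing the two equal functionals on the difference of their representing
      vectors shows that this difference has norm zero.\<close>
    from fun_cong[OF this, of "g' - g"] have "inner (g' - g) (g' - g) = 0"
      by (simp only: inner_diff_right)
    then show ?thesis
      by simp
  qed
  with g show ?thesis
    unfolding gradient_def by (rule theI)
qed

text \<open>Restricting \<open>V\<close> to the line through \<open>x\<close> and \<open>y\<close>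
  reduces the claim to the tangent inequality for a convex function of one real variable.\<close>

lemma convex_on_above_tangent_GDERIV:
  fixes V :: "'a::real_inner \<Rightarrow> real"
  assumes convex: "convex_on UNIV V" and deriv: "GDERIV V x :> g"
  shows "V y - V x \<ge> inner g (y - x)"
proof -
  define p where "p t = V (x + t *\<^sub>R (y - x))" for t
  have "convex_on UNIV p"
  proof (rule convex_onI)
    fix t a b :: real
    assume t: "0 < t" "t < 1"
    have "x + ((1 - t) *\<^sub>R a + t *\<^sub>R b) *\<^sub>R (y - x)
        = (1 - t) *\<^sub>R (x + a *\<^sub>R (y - x)) + t *\<^sub>R (x + b *\<^sub>R (y - x))"
      by (simp add: algebra_simps)
    with convex_onD[OF convex, of t] t
    show "p ((1 - t) *\<^sub>R a + t *\<^sub>R b) \<le> (1 - t) * p a + t * p b"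
      by (simp only: p_def) simp
  qed simp
  moreover have "(p has_real_derivative inner g (y - x)) (at 0)"
  proof -
    have "((\<lambda>t. x + t *\<^sub>R (y - x)) has_derivative (\<lambda>t. t *\<^sub>R (y - x))) (at (0::real))"
      by (auto intro!: derivative_eq_intros)
    \<comment> \<open>The base point is written as the value of the line at parameter 0, the form
      that the chain rule expects.\<close>
    moreover have "(V has_derivative (\<lambda>h. inner h g)) (at (x + 0 *\<^sub>R (y - x)))"
      using deriv by (simp add: gderiv_def)
    ultimately have "(p has_derivative (\<lambda>t. inner (t *\<^sub>R (y - x)) g)) (at 0)"
      unfolding p_def by (rule has_derivative_compose)
    moreover have "(\<lambda>t. inner (t *\<^sub>R (y - x)) g) = (*) (inner g (y - x))"
      by (simp add: fun_eq_iff inner_commute mult.commute)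
    ultimately show ?thesis
      by (simp add: has_field_derivative_def)
  qed
  \<comment> \<open>The tangent at parameter 0, where the line passes through \<open>x\<close>, is
    evaluated at parameter 1, where it reaches \<open>y\<close>.\<close>
  ultimately have "p 1 - p 0 \<ge> inner g (y - x) * (1 - 0)"
    by (intro convex_on_imp_above_tangent[where A = UNIV]) simp_all
  then show ?thesis
    by (simp add: p_def)
qed

theorem mainTheorem2:
  fixes f :: "(real^'n) \<times> (real^'m) \<Rightarrow> real^'n"
    and V :: "real^'n \<Rightarrow> real"
  assumes "continuous_on UNIV f"
    and "control_lyapunov_function V f"
    and "convex_on UNIV V"
  shows "\<forall>s\<in>{0..1::real}.
           control_lyapunov_function V (\<lambda>(x, u). (1 - s) *\<^sub>R f (x, u) - s *\<^sub>R x)"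
proof
  fix s :: real
  assume s: "s \<in> {0..1}"
  let ?h = "\<lambda>(x, u). (1 - s) *\<^sub>R f (x, u) - s *\<^sub>R x"
  have V: "C_infinity V" "V 0 = 0" "\<And>x. x \<noteq> 0 \<Longrightarrow> V x > 0"
      "\<And>x. x \<noteq> 0 \<Longrightarrow> (INF u. ereal (inner (gradient V x) (f (x, u)))) < 0"
    using assms(2) by (auto simp: control_lyapunov_function_def)
  have "continuous_on UNIV ?h"
    using assms(1) by (auto simp: case_prod_unfold intro!: continuous_intros)
  moreover have "(INF u. ereal (inner (gradient V x) (?h (x, u)))) < 0" if x: "x \<noteq> 0" for x
  proof -
    let ?g = "gradient V x"
    have "C_k (Suc 0) V"
      using V(1) unfolding C_infinity_def by blast
    then have "V differentiable (at x)"
      by simp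
    \<comment> \<open>The tangent at \<open>x\<close>, evaluated at the minimum point 0, gives
      \<open>inner ?g x\<close> \<ge> \<open>V x\<close>.\<close>
    from convex_on_above_tangent_GDERIV[OF assms(3) GDERIV_gradient[OF this], of 0]
    have decay: "inner ?g x > 0"
      using V(2) V(3)[OF x] by simp
    \<comment> \<open>A negative infimum, attained or not, forces some value to be negative. The
      chosen \<open>u\<close> comes from \<open>f\<close> alone and serves whatever \<open>s\<close>
      is.\<close>
    obtain u where u: "inner ?g (f (x, u)) < 0"
      using V(4)[OF x] by (auto simp: INF_less_iff)
    have "(1 - s) * inner ?g (f (x, u)) - s * inner ?g x < 0"
    \<comment> \<open>The source of strictness changes: for \<open>s = 0\<close> it is the choice of
      \<open>u\<close>; for \<open>s > 0\<close> it is the decay along \<open>-x\<close>, as the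
      \<open>f\<close> term vanishes at \<open>s = 1\<close>.\<close>
    proof (cases "s = 0")
      case False
      then have "s * inner ?g x > 0"
        using s decay by simp
      moreover have "(1 - s) * inner ?g (f (x, u)) \<le> 0"
        using s u by (simp add: mult_nonneg_nonpos)
      ultimately show ?thesis
        by linarith
    qed (use u in simp)
    then show ?thesis
      by (auto simp: INF_less_iff inner_diff_right)
  qed
  ultimately show "control_lyapunov_function V ?h"
    using assms(2) by (simp add: control_lyapunov_function_def)
qed

end
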